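(* Let $n,m\in\mathbb{N}$. Let $W_{\mathrm{EN}},W_{\mathrm{P}},W_{\mathrm{D}}\in\mathbb{R}^{nm\times nm}$ be diagonal positive semidefinite matrices, $W_{\mathrm{EX}}\in\mathbb{R}^{nm\times nm}$ a diagonal positive definite matrix, $\alpha_{\mathrm{F}}\ge 0$, and let $L_u\in\mathbb{R}^{nm\times nm}$ be the symmetrized-graph Laplacian lifted to $m$ topics (see context). Put $$Q:=W_{\mathrm{D}}+W_{\mathrm{P}},\qquad N:=-\tfrac12 W_{\mathrm{EN}},\qquad R:=W_{\mathrm{EX}}+\alpha_{\mathrm{F}}L_u,\qquad \widetilde Q:=Q-NR^{-1}N.$$ Suppose $Q$, $R$ and $N$ are simultaneously orthogonally diagonalizable, that is, there exist an orthogonal matrix $U\in\mathbb{R}^{nm\times nm}$ and vectors $q,r\in\mathbb{R}^{nm}_{>0}$, $w_{\mathrm{EN}}\in\mathbb{R}^{nm}_{\ge 0}$ such that $$Q=U\,\mathrm{diag}(q)\,U^\top,\qquad R=U\,\mathrm{diag}(r)\,U^\top,\qquad W_{\mathrm{EN}}=U\,\mathrm{diag}(w_{\mathrm{EN}})\,U^\top .$$ Then $$\begin{bmatrix}\widetilde Q & O_{nm}\\ O_{nm} & R\end{bmatrix}\succ 0\quad\Longleftrightarrow\quad q_i>\frac{w_{\mathrm{EN},i}^2}{4\,r_i}\ \text{ for all } i\in\{1,\dots,nm\}.$$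
   Context: Let $\Gamma\in\mathbb{R}^{n\times n}$ be the adjacency matrix, with nonnegative entries, of a connected directed weighted graph on $n$ vertices (connected meaning that the underlying undirected graph is connected). Set $\Gamma_b:=\tfrac12(\Gamma+\Gamma^\top)$, $\Delta_b:=\mathrm{diag}(\Gamma_b\mathbf{1}_n)$, $L_b:=\Delta_b-\Gamma_b$, and $L_u:=I_m\otimes L_b$, where $\mathbf{1}_n$ is the vector of ones, $I_m$ is the $m\times m$ identity matrix and $\otimes$ is the Kronecker product. $O_{nm}$ denotes the $nm\times nm$ zero matrix, and $M\succ 0$ means that the symmetric matrix $M$ is positive definite. Here $w_{\mathrm{EN},i}$ denotes the $i$-th entry of the vector $w_{\mathrm{EN}}$ in the simultaneous diagonalization (eigenvalues of $W_{\mathrm{EN}}$ ordered according to the columns of $U$). Vectors in $\mathbb{R}^{nm}_{>0}$ (resp. $\mathbb{R}^{nm}_{\ge0}$) have all entries positive (resp. nonnegative). *)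

theory Defs
  imports "HOL-Analysis.Analysis"
begin

definition diag_matrix :: "real^'k \<Rightarrow> real^'k^'k" where
  "diag_matrix d = (\<chi> i j. if i = j then d $ i else 0)"

definition is_diagonal :: "real^'k^'k \<Rightarrow> bool" where
  "is_diagonal A \<longleftrightarrow> (\<forall>i j. i \<noteq> j \<longrightarrow> A $ i $ j = 0)"

definition symmetric_matrix :: "real^'k^'k \<Rightarrow> bool" where
  "symmetric_matrix A \<longleftrightarrow> transpose A = A"

definition pos_semidef :: "real^'k^'k \<Rightarrow> bool" where
  "pos_semidef A \<longleftrightarrow> symmetric_matrix A \<and> (\<forall>x. 0 \<le> x \<bullet> (A *v x))"

definition pos_def :: "real^'k^'k \<Rightarrow> bool" where
  "pos_def A \<longleftrightarrow> symmetric_matrix A \<and> (\<forall>x. x \<noteq> 0 \<longrightarrow> 0 < x \<bullet> (A *v x))"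

definition kronecker :: "real^'b^'a \<Rightarrow> real^'d^'c \<Rightarrow> real^('b \<times> 'd)^('a \<times> 'c)" where
  "kronecker A B = (\<chi> p q. A $ fst p $ fst q * B $ snd p $ snd q)"

definition block_matrix ::
  "real^'c^'a \<Rightarrow> real^'d^'a \<Rightarrow> real^'c^'b \<Rightarrow> real^'d^'b \<Rightarrow> real^('c + 'd)^('a + 'b)" where
  "block_matrix A B C D = (\<chi> p q.
     (case p of
        Inl i \<Rightarrow> (case q of Inl j \<Rightarrow> A $ i $ j | Inr j \<Rightarrow> B $ i $ j)
      | Inr i \<Rightarrow> (case q of Inl j \<Rightarrow> C $ i $ j | Inr j \<Rightarrow> D $ i $ j)))"

text \<open>The vertices are the elements of the index type, and there is an edge between two of them
  exactly where the adjacency matrix has a nonzero entry.\<close>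

definition weakly_connected :: "real^'n^'n \<Rightarrow> bool" where
  "weakly_connected \<Gamma> \<longleftrightarrow> (\<forall>i j. (i, j) \<in> {(k, l). \<Gamma> $ k $ l \<noteq> 0 \<or> \<Gamma> $ l $ k \<noteq> 0}\<^sup>*)"

definition connected_adjacency_matrix :: "real^'n^'n \<Rightarrow> bool" where
  "connected_adjacency_matrix \<Gamma> \<longleftrightarrow> (\<forall>i j. 0 \<le> \<Gamma> $ i $ j) \<and> weakly_connected \<Gamma>"

definition sym_adj :: "real^'n^'n \<Rightarrow> real^'n^'n" where
  "sym_adj \<Gamma> = (1 / 2) *\<^sub>R (\<Gamma> + transpose \<Gamma>)"

definition sym_laplacian :: "real^'n^'n \<Rightarrow> real^'n^'n" where
  "sym_laplacian \<Gamma> = diag_matrix (sym_adj \<Gamma> *v (\<chi> i. 1)) - sym_adj \<Gamma>"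

text \<open>An index \<open>(k, i)\<close> of the lifted matrix stands for topic \<open>k\<close> and vertex \<open>i\<close>.\<close>

definition lifted_laplacian :: "real^'n^'n \<Rightarrow> real^('m::finite \<times> 'n)^('m \<times> 'n)" where
  "lifted_laplacian \<Gamma> = kronecker (mat 1 :: real^'m^'m) (sym_laplacian \<Gamma>)"

end

theory Submission
  imports Defs
begin

text \<open>The columns of \<open>U\<close> form a common orthonormal eigenbasis, in which the claim
  becomes scalar. Conjugating diagonal matrices by \<open>U\<close> respects products and
  differences, so the inverse of \<open>R\<close> has eigenvalues 1 / r_i, and Q' = Q - N R^-1 N has
  eigenvalues q_i - w_i^2 / (4 r_i). A block diagonal matrix is positive definite iff both blocks
  are (\<open>pos_def_block_diagonal\<close>), orthogonal conjugation preserves definiteness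
  (\<open>pos_def_orthogonal_congruence_iff\<close>), and a diagonal matrix is positive definite iff
  its entries are positive (\<open>pos_def_diag_matrix\<close>). The block \<open>R\<close> is
  positive definite since r > 0, so exactly the inequalities on the eigenvalues of Q'
  remain.\<close>

lemma diag_matrix_vec_nth: "(diag_matrix d *v x) $ i = d $ i * x $ i"
proof -
  have "(diag_matrix d *v x) $ i = (\<Sum>j\<in>UNIV. (if i = j then d $ i else 0) * x $ j)"
    by (simp add: diag_matrix_def matrix_vector_mult_def)
  also have "\<dots> = (\<Sum>j\<in>UNIV. if i = j then d $ i * x $ j else 0)"
    by (intro sum.cong) simp_all
  finally show ?thesis by simp
qed

lemma diag_matrix_mult: "diag_matrix a ** diag_matrix b = diag_matrix (\<chi> i. a $ i * b $ i)"
  by (simp add: matrix_eq vec_eq_iff diag_matrix_vec_nth flip: matrix_vector_mul_assoc)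

lemma transpose_diag_matrix [simp]: "transpose (diag_matrix d) = diag_matrix d"
  by (simp add: diag_matrix_def transpose_def vec_eq_iff)

lemma diag_matrix_1: "diag_matrix (\<chi> i. 1) = mat 1"
  by (simp add: diag_matrix_def mat_def vec_eq_iff)

lemma diag_matrix_diff: "diag_matrix a - diag_matrix b = diag_matrix (a - b)"
  by (simp add: diag_matrix_def vec_eq_iff)

lemma scaleR_diag_matrix: "c *\<^sub>R diag_matrix a = diag_matrix (c *\<^sub>R a)"
  by (simp add: diag_matrix_def vec_eq_iff)

lemma matrix_diff_ldistrib: "A ** (B - C) = A ** B - A ** (C :: 'a::ring_1^'n^'m)"
  by (simp add: matrix_matrix_mult_def vec_eq_iff right_diff_distrib sum_subtractf)

lemma matrix_diff_rdistrib: "(A - B) ** C = A ** C - B ** (C :: 'a::ring_1^'n^'m)"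
  by (simp add: matrix_matrix_mult_def vec_eq_iff left_diff_distrib sum_subtractf)

text \<open>The quadratic form is the sum of d_i x_i^2; the unit vectors isolate the single
  entries.\<close>

lemma pos_def_diag_matrix: "pos_def (diag_matrix d) \<longleftrightarrow> (\<forall>i. 0 < d $ i)"
proof
  assume pd: "pos_def (diag_matrix d)"
  show "\<forall>i. 0 < d $ i"
  proof
    fix i
    have "axis i 1 \<noteq> (0 :: real^'a)" by (simp add: axis_eq_0_iff)
    with pd have "0 < axis i 1 \<bullet> (diag_matrix d *v axis i 1)" by (simp add: pos_def_def)
    then show "0 < d $ i" by (simp add: inner_axis' diag_matrix_vec_nth)
  qed
next
  assume d: "\<forall>i. 0 < d $ i"
  have "0 < x \<bullet> (diag_matrix d *v x)" if "x \<noteq> 0" for x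
  proof -
    from that obtain i where "x $ i \<noteq> 0" by (auto simp: vec_eq_iff)
    then have "0 < (\<Sum>i\<in>UNIV. d $ i * (x $ i)\<^sup>2)"
      using d by (intro sum_pos2[of _ i]) (simp_all add: less_imp_le)
    then show ?thesis
      by (simp add: inner_vec_def diag_matrix_vec_nth power2_eq_square mult.left_commute)
  qed
  then show "pos_def (diag_matrix d)" by (simp add: pos_def_def symmetric_matrix_def)
qed

text \<open>The substitution y = P^T x turns one quadratic form into the other, and it keeps nonzero
  vectors nonzero because P^T is invertible.\<close>

lemma pos_def_congruence:
  fixes A P :: "real^'k^'k"
  assumes A: "pos_def A" and P: "invertible P"
  shows "pos_def (P ** A ** transpose P)"
proof -
  have "0 < x \<bullet> ((P ** A ** transpose P) *v x)" if "x \<noteq> 0" for x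
  proof -
    have "transpose P *v x \<noteq> 0"
      using P that by (metis invertible_def transpose_invertible matrix_vector_mul_assoc
          matrix_vector_mul_lid matrix_vector_mult_0_right)
    with A have "0 < (transpose P *v x) \<bullet> (A *v (transpose P *v x))"
      by (simp add: pos_def_def)
    also have "\<dots> = x \<bullet> (P *v (A *v (transpose P *v x)))"
      by (simp add: dot_lmul_matrix)
    finally show ?thesis by (simp only: matrix_vector_mul_assoc matrix_mul_assoc)
  qed
  with A show ?thesis
    by (simp add: pos_def_def symmetric_matrix_def matrix_transpose_mul matrix_mul_assoc)
qed

lemma pos_def_orthogonal_congruence_iff:
  fixes A U :: "real^'k^'k"
  assumes U: "orthogonal_matrix U"
  shows "pos_def (U ** A ** transpose U) \<longleftrightarrow> pos_def A"
proof
  have [simp]: "transpose U ** U = mat 1" using U by (simp add: orthogonal_matrix)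
  have inv: "invertible U" "invertible (transpose U)"
    using U unfolding invertible_def orthogonal_matrix_def by (metis transpose_transpose)+
  {
    assume "pos_def (U ** A ** transpose U)"
    \<comment> \<open>Conjugating back by U^T gives U^T U A U^T U. Bracketing to the left cancels
      the first pair, bracketing to the right the second.\<close>
    from pos_def_congruence[OF this inv(2)] show "pos_def A"
      by (simp add: matrix_mul_assoc) (simp flip: matrix_mul_assoc)
  }
  show "pos_def A \<Longrightarrow> pos_def (U ** A ** transpose U)"
    using inv by (simp add: pos_def_congruence)
qed

lemma sum_UNIV_Plus:
  "(\<Sum>p\<in>(UNIV :: ('a::finite + 'b::finite) set). f p)
    = (\<Sum>i\<in>UNIV. f (Inl i)) + (\<Sum>j\<in>UNIV. f (Inr j))"
  by (simp add: UNIV_Plus_UNIV[symmetric] sum.Plus del: UNIV_Plus_UNIV)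

text \<open>With zero off-diagonal blocks there are no cross terms between the two halves of
  \<open>z\<close>.\<close>

lemma inner_block_diagonal:
  fixes A :: "real^'a^'a" and B :: "real^'b^'b" and z :: "real^('a + 'b)"
  defines "x \<equiv> \<chi> i. z $ Inl i" and "y \<equiv> \<chi> j. z $ Inr j"
  shows "z \<bullet> (block_matrix A 0 0 B *v z) = x \<bullet> (A *v x) + y \<bullet> (B *v y)"
  by (simp add: x_def y_def inner_vec_def matrix_vector_mult_def block_matrix_def sum_UNIV_Plus)

lemma pos_def_block_diagonal:
  fixes A :: "real^'a^'a" and B :: "real^'b^'b"
  shows "pos_def (block_matrix A 0 0 B) \<longleftrightarrow> pos_def A \<and> pos_def B" (is "pos_def ?M \<longleftrightarrow> _")
proof -
  have sym: "symmetric_matrix ?M \<longleftrightarrow> symmetric_matrix A \<and> symmetric_matrix B"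
    by (simp add: symmetric_matrix_def transpose_def block_matrix_def vec_eq_iff split_sum_all)
  show ?thesis
  proof (intro iffI conjI)
    assume M: "pos_def ?M"
    show "pos_def A"
      unfolding pos_def_def
    proof (intro conjI allI impI)
      show "symmetric_matrix A" using M sym by (simp add: pos_def_def)
      fix x :: "real^'a" assume "x \<noteq> 0"
      \<comment> \<open>Padding with zeros silences the other block, so the form of the whole matrix
        restricts to that of \<open>A\<close>.\<close>
      let ?z = "(\<chi> p. case p of Inl i \<Rightarrow> x $ i | Inr j \<Rightarrow> 0) :: real^('a + 'b)"
      have "?z \<noteq> 0" using \<open>x \<noteq> 0\<close> by (auto simp: vec_eq_iff split_sum_ex)
      with M have "0 < ?z \<bullet> (?M *v ?z)" unfolding pos_def_def by blast
      then show "0 < x \<bullet> (A *v x)" by (simp add: inner_block_diagonal) (simp add: inner_vec_def)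
    qed
    show "pos_def B"
      unfolding pos_def_def
    proof (intro conjI allI impI)
      show "symmetric_matrix B" using M sym by (simp add: pos_def_def)
      fix y :: "real^'b" assume "y \<noteq> 0"
      let ?z = "(\<chi> p. case p of Inl i \<Rightarrow> 0 | Inr j \<Rightarrow> y $ j) :: real^('a + 'b)"
      have "?z \<noteq> 0" using \<open>y \<noteq> 0\<close> by (auto simp: vec_eq_iff split_sum_ex)
      with M have "0 < ?z \<bullet> (?M *v ?z)" unfolding pos_def_def by blast
      then show "0 < y \<bullet> (B *v y)" by (simp add: inner_block_diagonal) (simp add: inner_vec_def)
    qed
  next
    assume AB: "pos_def A \<and> pos_def B"
    have "0 < z \<bullet> (?M *v z)" if "z \<noteq> 0" for z
    proof -
      define x y where "x = (\<chi> i. z $ Inl i)" and "y = (\<chi> j. z $ Inr j)"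
      have "x \<noteq> 0 \<or> y \<noteq> 0"
        using that by (auto simp: x_def y_def vec_eq_iff split_sum_ex)
      \<comment> \<open>One half of \<open>z\<close> may vanish; its form is then 0, and strictness
        comes from the other half.\<close>
      moreover have "0 \<le> x \<bullet> (A *v x)" "0 \<le> y \<bullet> (B *v y)"
        using AB by (cases "x = 0"; cases "y = 0"; force simp: pos_def_def less_imp_le)+
      ultimately have "0 < x \<bullet> (A *v x) + y \<bullet> (B *v y)"
        using AB by (auto simp: pos_def_def intro: add_pos_nonneg add_nonneg_pos)
      then show ?thesis by (simp add: inner_block_diagonal x_def y_def)
    qed
    with AB sym show "pos_def ?M" by (simp add: pos_def_def)
  qed
qed

text \<open>\<open>matrix_inv\<close> is a choice among two-sided inverses. For square matrices a
  right inverse is also a left inverse, and C = (B A) C = B (A C) = B leaves only one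
  candidate.\<close>

lemma matrix_inv_eqI:
  fixes A B :: "real^'k^'k"
  assumes "A ** B = mat 1"
  shows "matrix_inv A = B"
proof -
  have BA: "B ** A = mat 1" using assms by (rule iffD1[OF matrix_left_right_inverse])
  show ?thesis
    unfolding matrix_inv_def
  proof (rule some_equality)
    show "A ** B = mat 1 \<and> B ** A = mat 1" using assms BA by blast
    fix C assume "A ** C = mat 1 \<and> C ** A = mat 1"
    then have "C = (B ** A) ** C" "B ** (A ** C) = B" by (simp_all add: BA)
    then show "C = B" by (simp add: matrix_mul_assoc)
  qed
qed

theorem corollary4:
  fixes \<Gamma> :: "real^'n^'n"
    and W_EN W_P W_D W_EX :: "real^('m::finite \<times> 'n::finite)^('m::finite \<times> 'n::finite)"
    and Q N R Q' U :: "real^('m::finite \<times> 'n::finite)^('m::finite \<times> 'n::finite)"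
    and q r w :: "real^('m::finite \<times> 'n::finite)"
    and \<alpha>_F :: real
  assumes "connected_adjacency_matrix \<Gamma>"
    and "is_diagonal W_EN" and "pos_semidef W_EN"
    and "is_diagonal W_P" and "pos_semidef W_P"
    and "is_diagonal W_D" and "pos_semidef W_D"
    and "is_diagonal W_EX" and "pos_def W_EX"
    and "\<alpha>_F \<ge> 0"
    and "Q = W_D + W_P"
    and "N = - ((1 / 2) *\<^sub>R W_EN)"
    and "R = W_EX + \<alpha>_F *\<^sub>R lifted_laplacian \<Gamma>"
    and "Q' = Q - N ** matrix_inv R ** N"
    and "orthogonal_matrix U"
    and "\<forall>i. q $ i > 0" and "\<forall>i. r $ i > 0" and "\<forall>i. w $ i \<ge> 0"
    and "Q = U ** diag_matrix q ** transpose U"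
    and "R = U ** diag_matrix r ** transpose U"
    and "W_EN = U ** diag_matrix w ** transpose U"
  shows "pos_def (block_matrix Q' 0 0 R) \<longleftrightarrow> (\<forall>i. q $ i > (w $ i)\<^sup>2 / (4 * r $ i))"
proof -
  \<comment> \<open>\<open>c\<close> embeds vectors with entrywise operations into the matrices
    diagonalized by \<open>U\<close>, so matrix identities reduce to entrywise ones.\<close>
  define c where "c d = U ** diag_matrix d ** transpose U" for d :: "real^('m \<times> 'n)"
  have U: "transpose U ** U = mat 1" "U ** transpose U = mat 1"
    using assms(15) by (simp_all add: orthogonal_matrix_def)
  have c_mult: "c a ** c b = c (\<chi> i. a $ i * b $ i)" for a b
  proof -
    have "c a ** c b = U ** diag_matrix a ** (transpose U ** U) ** diag_matrix b ** transpose U"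
      by (simp add: c_def matrix_mul_assoc)
    also have "\<dots> = U ** (diag_matrix a ** diag_matrix b) ** transpose U"
      by (simp add: U matrix_mul_assoc)
    finally show ?thesis by (simp add: c_def diag_matrix_mult)
  qed
  have c_diff: "c a - c b = c (a - b)" for a b
    by (simp add: c_def matrix_diff_ldistrib matrix_diff_rdistrib flip: diag_matrix_diff)
  have c_scaleR: "k *\<^sub>R c a = c (k *\<^sub>R a)" for k a
    by (simp add: c_def scalar_matrix_assoc matrix_scalar_ac flip: scaleR_diag_matrix)
  have r: "r $ i > 0" for i using assms(17) by blast
  have Q: "Q = c q" and R: "R = c r" and W: "W_EN = c w"
    using assms(19-21) by (simp_all add: c_def)
  have N: "N = c (- (1/2) *\<^sub>R w)"
    unfolding assms(12) W c_scaleR[symmetric] by simp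
  have "R ** c (\<chi> i. 1 / r $ i) = mat 1"
  proof -
    have "R ** c (\<chi> i. 1 / r $ i) = c (\<chi> i. 1)"
      using r by (simp add: R c_mult less_imp_neq[symmetric])
    then show ?thesis by (simp add: c_def diag_matrix_1 U)
  qed
  then have "matrix_inv R = c (\<chi> i. 1 / r $ i)" by (rule matrix_inv_eqI)
  \<comment> \<open>Entrywise, (-w_i/2) (1/r_i) (-w_i/2) = w_i^2 / (4 r_i).\<close>
  then have "Q' = c (\<chi> i. q $ i - (w $ i)\<^sup>2 / (4 * r $ i))"
    by (simp only: assms(14) Q N c_mult c_diff, intro arg_cong[where f = c],
        simp add: vec_eq_iff power2_eq_square)
  moreover have pd_c: "pos_def (c d) \<longleftrightarrow> (\<forall>i. 0 < d $ i)" for d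
    by (simp add: c_def pos_def_orthogonal_congruence_iff[OF assms(15)] pos_def_diag_matrix)
  ultimately show ?thesis
    \<comment> \<open>Positivity of \<open>r\<close> settles the block \<open>R\<close>. Indices are
      pairs of topic and vertex; the quantifier over them is kept whole so that it matches
      \<open>pd_c\<close> and \<open>r\<close>.\<close>
    using r by (simp add: pos_def_block_diagonal R del: split_paired_All)
qed

end
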